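(* Let $G$ be a discrete group endowed with the discrete metric. Then $L(G)$ is a contractible space, endowed with a free action of $G$ (by left translations, $(g.f)(t)=g\,f(t)$) such that the quotient map $L(G)\to L(G)/G$ is a covering map.
   Context: $\Omega$ denotes an uncountable standard Borel space endowed with a non-atomic probability measure $\mu$ (for instance $[0,1]$ with Lebesgue measure); integration against $\mu$ is written $dt$. The discrete metric on $G$ is $d(x,y)=1$ if $x\neq y$ and $d(x,x)=0$. $L(G)=L(\Omega,G)$ is the set of Borel maps $\Omega\to G$ modulo almost-everywhere equality, with the metric $d(f_1,f_2)=\int_\Omega d(f_1(t),f_2(t))\,dt$. *)

theory Defs
  imports "HOL-Probability.Probability" "HOL-Algebra.Group_Action"
begin

section \<open>Non-atomic standard Borel probability spaces\<close>

text \<open>The measurable sets are exactly the Borel sets of a Polish topology on the underlying set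
  (in particular the \<sigma>-algebra is not completed).\<close>

definition standard_borel :: "'a measure \<Rightarrow> bool" where
  "standard_borel M \<longleftrightarrow>
     (\<exists>X. completely_metrizable_space X \<and> second_countable X \<and>
          topspace X = space M \<and> sets M = sigma_sets (space M) {U. openin X U})"

definition nonatomic :: "'a measure \<Rightarrow> bool" where
  "nonatomic M \<longleftrightarrow>
     (\<forall>A\<in>sets M. 0 < emeasure M A \<longrightarrow>
        (\<exists>B\<in>sets M. B \<subseteq> A \<and> 0 < emeasure M B \<and> emeasure M B < emeasure M A))"

section \<open>The space \<open>L(\<Omega>, G)\<close>\<close>

text \<open>Every subset of the discrete space \<open>G\<close> is open, so its Borel \<sigma>-algebra is the full power
  set, which is that of \<^term>\<open>count_space (carrier G)\<close>; only this \<sigma>-algebra is used, not the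
  counting measure.  No countability of \<open>G\<close> is assumed.\<close>

definition borel_maps :: "'a measure \<Rightarrow> ('g, 'm) monoid_scheme \<Rightarrow> ('a \<Rightarrow> 'g) set" where
  "borel_maps M G = M \<rightarrow>\<^sub>M count_space (carrier G)"

text \<open>Values outside \<^term>\<open>space M\<close> are arbitrary, but \<open>AE\<close> ignores them.\<close>

definition ae_rel ::
    "'a measure \<Rightarrow> ('g, 'm) monoid_scheme \<Rightarrow> (('a \<Rightarrow> 'g) \<times> ('a \<Rightarrow> 'g)) set" where
  "ae_rel M G = {(f, h). f \<in> borel_maps M G \<and> h \<in> borel_maps M G \<and> (AE t in M. f t = h t)}"

definition L :: "'a measure \<Rightarrow> ('g, 'm) monoid_scheme \<Rightarrow> ('a \<Rightarrow> 'g) set set" where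
  "L M G = borel_maps M G // ae_rel M G"

lemma equiv_ae_rel: "equiv (borel_maps M G) (ae_rel M G)"
proof (rule equivI)
  show "ae_rel M G \<subseteq> borel_maps M G \<times> borel_maps M G"
    by (auto simp: ae_rel_def)
  show "refl_on (borel_maps M G) (ae_rel M G)"
    by (auto simp: refl_on_def ae_rel_def)
  show "sym (ae_rel M G)"
    by (auto simp: sym_def ae_rel_def eq_commute)
  show "trans (ae_rel M G)"
  proof (rule transI)
    fix f g h assume fg: "(f, g) \<in> ae_rel M G" and gh: "(g, h) \<in> ae_rel M G"
    have "AE t in M. f t = g t" "AE t in M. g t = h t"
      using fg gh by (auto simp: ae_rel_def)
    then have "AE t in M. f t = h t"
      by eventually_elim simp
    with fg gh show "(f, h) \<in> ae_rel M G"
      by (auto simp: ae_rel_def)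
  qed
qed

text \<open>The Lebesgue integral of \<open>d(f(t), h(t))\<close>, with \<open>d\<close> the discrete metric and \<open>f\<close>, \<open>h\<close>
  arbitrary representatives; see \<open>L_dist_class\<close> for independence of the choice.\<close>

definition L_dist :: "'a measure \<Rightarrow> ('a \<Rightarrow> 'g) set \<Rightarrow> ('a \<Rightarrow> 'g) set \<Rightarrow> real" where
  "L_dist M A B =
     enn2real (\<integral>\<^sup>+t. ennreal (discrete_metric.dd ((SOME f. f \<in> A) t) ((SOME h. h \<in> B) t)) \<partial>M)"

lemma L_dist_class:
  assumes f: "f \<in> borel_maps M G" and h: "h \<in> borel_maps M G"
  shows "L_dist M (ae_rel M G `` {f}) (ae_rel M G `` {h}) =
         enn2real (\<integral>\<^sup>+t. ennreal (discrete_metric.dd (f t) (h t)) \<partial>M)"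
proof -
  have *: "AE t in M. (SOME u. u \<in> ae_rel M G `` {v}) t = v t" if "v \<in> borel_maps M G" for v
  proof -
    have "(SOME u. u \<in> ae_rel M G `` {v}) \<in> ae_rel M G `` {v}"
      using equiv_class_self[OF equiv_ae_rel that] by (rule someI[of "\<lambda>u. u \<in> ae_rel M G `` {v}"])
    then show ?thesis
      by (auto simp: ae_rel_def eq_commute)
  qed
  have "(\<integral>\<^sup>+t. ennreal (discrete_metric.dd ((SOME u. u \<in> ae_rel M G `` {f}) t)
                                         ((SOME u. u \<in> ae_rel M G `` {h}) t)) \<partial>M) =
        (\<integral>\<^sup>+t. ennreal (discrete_metric.dd (f t) (h t)) \<partial>M)"
  proof (rule nn_integral_cong_AE)
    show "AE t in M. ennreal (discrete_metric.dd ((SOME u. u \<in> ae_rel M G `` {f}) t)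
                                                 ((SOME u. u \<in> ae_rel M G `` {h}) t)) =
                     ennreal (discrete_metric.dd (f t) (h t))"
      using *[OF f] *[OF h] by eventually_elim simp
  qed
  then show ?thesis
    by (simp add: L_dist_def)
qed

definition L_top :: "'a measure \<Rightarrow> ('g, 'm) monoid_scheme \<Rightarrow> ('a \<Rightarrow> 'g) set topology" where
  "L_top M G = Metric_space.mtopology (L M G) (L_dist M)"

section \<open>Left translation\<close>

text \<open>\<open>(g.f)(t) = g f(t)\<close> on classes; see \<open>L_act_class\<close>. The restriction to \<^term>\<open>L M G\<close> is
  there because \<^const>\<open>group_action\<close> asks for extensional functions.\<close>

definition L_act ::
    "'a measure \<Rightarrow> ('g, 'm) monoid_scheme \<Rightarrow> 'g \<Rightarrow> ('a \<Rightarrow> 'g) set \<Rightarrow> ('a \<Rightarrow> 'g) set" where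
  "L_act M G g = (\<lambda>A\<in>L M G. \<Union>f\<in>A. ae_rel M G `` {\<lambda>t. g \<otimes>\<^bsub>G\<^esub> f t})"

lemma L_act_class:
  assumes "group G" and g: "g \<in> carrier G" and f: "f \<in> borel_maps M G"
  shows "L_act M G g (ae_rel M G `` {f}) = ae_rel M G `` {\<lambda>t. g \<otimes>\<^bsub>G\<^esub> f t}"
proof -
  interpret group G by fact
  have meas: "(\<lambda>t. g \<otimes>\<^bsub>G\<^esub> u t) \<in> borel_maps M G" if "u \<in> borel_maps M G" for u
  proof -
    have "(\<lambda>x. g \<otimes>\<^bsub>G\<^esub> x) \<in> count_space (carrier G) \<rightarrow>\<^sub>M count_space (carrier G)"
      using g by auto
    from measurable_compose[OF that[unfolded borel_maps_def] this] show ?thesis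
      by (simp add: borel_maps_def)
  qed
  have "(\<lambda>u. ae_rel M G `` {\<lambda>t. g \<otimes>\<^bsub>G\<^esub> u t}) respects ae_rel M G"
  proof (rule congruentI)
    fix u v assume uv: "(u, v) \<in> ae_rel M G"
    then have "AE t in M. u t = v t"
      by (simp add: ae_rel_def)
    then have "AE t in M. g \<otimes>\<^bsub>G\<^esub> u t = g \<otimes>\<^bsub>G\<^esub> v t"
      by eventually_elim simp
    with uv have "(\<lambda>t. g \<otimes>\<^bsub>G\<^esub> u t, \<lambda>t. g \<otimes>\<^bsub>G\<^esub> v t) \<in> ae_rel M G"
      using meas by (simp add: ae_rel_def)
    then show "ae_rel M G `` {\<lambda>t. g \<otimes>\<^bsub>G\<^esub> u t} = ae_rel M G `` {\<lambda>t. g \<otimes>\<^bsub>G\<^esub> v t}"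
      by (rule equiv_class_eq[OF equiv_ae_rel])
  qed
  from UN_equiv_class[OF equiv_ae_rel this f] show ?thesis
    using quotientI[OF f] by (simp add: L_act_def L_def)
qed

section \<open>Free actions, quotient topologies, covering maps\<close>

definition free_action ::
    "('g, 'm) monoid_scheme \<Rightarrow> 'x set \<Rightarrow> ('g \<Rightarrow> 'x \<Rightarrow> 'x) \<Rightarrow> bool" where
  "free_action G E \<phi> \<longleftrightarrow>
     group_action G E \<phi> \<and> (\<forall>g\<in>carrier G. \<forall>x\<in>E. \<phi> g x = x \<longrightarrow> g = \<one>\<^bsub>G\<^esub>)"

text \<open>Joint continuity, the group carrying its discrete topology.\<close>

definition continuous_action ::
    "('g, 'm) monoid_scheme \<Rightarrow> 'x topology \<Rightarrow> ('g \<Rightarrow> 'x \<Rightarrow> 'x) \<Rightarrow> bool" where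
  "continuous_action G X \<phi> \<longleftrightarrow>
     continuous_map (prod_topology (discrete_topology (carrier G)) X) X (\<lambda>(g, x). \<phi> g x)"

definition quotient_topology :: "'x topology \<Rightarrow> ('x \<Rightarrow> 'y) \<Rightarrow> 'y topology" where
  "quotient_topology X p =
     topology (\<lambda>U. U \<subseteq> p ` topspace X \<and> openin X {x \<in> topspace X. p x \<in> U})"

lemma openin_quotient_topology:
  "openin (quotient_topology X p) U \<longleftrightarrow>
     U \<subseteq> p ` topspace X \<and> openin X {x \<in> topspace X. p x \<in> U}"
proof -
  have "istopology (\<lambda>U. U \<subseteq> p ` topspace X \<and> openin X {x \<in> topspace X. p x \<in> U})"
    unfolding istopology_def
  proof (intro conjI allI impI; (elim conjE)?)
    fix S T
    assume "openin X {x \<in> topspace X. p x \<in> S}" "openin X {x \<in> topspace X. p x \<in> T}"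
    then have "openin X ({x \<in> topspace X. p x \<in> S} \<inter> {x \<in> topspace X. p x \<in> T})"
      by (rule openin_Int)
    also have "{x \<in> topspace X. p x \<in> S} \<inter> {x \<in> topspace X. p x \<in> T} =
               {x \<in> topspace X. p x \<in> S \<inter> T}"
      by auto
    finally show "openin X {x \<in> topspace X. p x \<in> S \<inter> T}" .
  next
    fix \<U>
    assume *: "\<forall>K\<in>\<U>. K \<subseteq> p ` topspace X \<and> openin X {x \<in> topspace X. p x \<in> K}"
    then have "openin X (\<Union>K\<in>\<U>. {x \<in> topspace X. p x \<in> K})"
      by blast
    also have "(\<Union>K\<in>\<U>. {x \<in> topspace X. p x \<in> K}) = {x \<in> topspace X. p x \<in> \<Union>\<U>}"
      by auto
    finally show "openin X {x \<in> topspace X. p x \<in> \<Union>\<U>}" .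
  qed blast+
  then show ?thesis
    by (simp add: quotient_topology_def)
qed

lemma topspace_quotient_topology [simp]: "topspace (quotient_topology X p) = p ` topspace X"
proof (rule subset_antisym)
  show "topspace (quotient_topology X p) \<subseteq> p ` topspace X"
    using openin_topspace[of "quotient_topology X p"] by (simp only: openin_quotient_topology)
  have "{x \<in> topspace X. p x \<in> p ` topspace X} = topspace X"
    by auto
  then have "openin (quotient_topology X p) (p ` topspace X)"
    by (simp add: openin_quotient_topology)
  then show "p ` topspace X \<subseteq> topspace (quotient_topology X p)"
    by (rule openin_subset)
qed

lemma quotient_map_quotient_topology: "quotient_map X (quotient_topology X p) p"
  by (auto simp: quotient_map_def openin_quotient_topology)

text \<open>The analogue of \<^const>\<open>covering_space\<close> for abstract topologies.\<close>

definition covering_map :: "'x topology \<Rightarrow> 'y topology \<Rightarrow> ('x \<Rightarrow> 'y) \<Rightarrow> bool" where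
  "covering_map X Y p \<longleftrightarrow>
     continuous_map X Y p \<and> p ` topspace X = topspace Y \<and>
     (\<forall>y\<in>topspace Y. \<exists>U. openin Y U \<and> y \<in> U \<and>
        (\<exists>\<V>. \<Union>\<V> = {x \<in> topspace X. p x \<in> U} \<and>
             (\<forall>V\<in>\<V>. openin X V) \<and> pairwise disjnt \<V> \<and>
             (\<forall>V\<in>\<V>. homeomorphic_map (subtopology X V) (subtopology Y U) p)))"

end

theory Submission
  imports Defs
begin

text \<open>
  The distance of two classes is the probability that their representatives disagree, and
  everything rests on this formula.  For the formula to be meaningful the set where two Borel maps
  disagree has to be measurable.  This is not automatic when \<open>G\<close> is uncountable, since the diagonal
  of \<open>G \<times> G\<close> may fail to lie in the product \<open>\<sigma>\<close>-algebra; it holds here because \<open>\<Omega>\<close> has a countable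
  separating family of Borel sets, which can be transported to the range of one of the maps
  (\<open>pred_neq\<close>).

  The contraction overwrites a map by the neutral element on a growing part of \<open>\<Omega>\<close>.  The growing
  parts are the sublevel sets of a random variable \<open>\<tau>\<close> with values in \<open>[0, 1]\<close> whose fibres are
  null sets (\<open>ex_null_fibres\<close>): a standard Borel space admits an injective Borel map to \<open>[0, 1]\<close>, and
  points are null in a non-atomic space.  The measure of the sublevel sets is then a continuous
  function of the level, and two overwritten maps disagree only where the original maps do or
  between the two levels, which gives joint continuity (\<open>contractible_space_L\<close>).

  Left translations by elements of \<open>G\<close> are isometries, because \<open>g f(t) = g h(t)\<close> exactly where
  \<open>f(t) = h(t)\<close>.  A translate of \<open>f\<close> by \<open>g \<noteq> \<one>\<close> disagrees with \<open>f\<close> at every point, hence lies at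
  distance \<open>1\<close> from it.  So the action is free, and a ball of radius \<open>1/2\<close> is disjoint from all its
  proper translates, which by the general criterion \<open>covering_map_orbit\<close> makes the quotient map a
  covering.
\<close>

section \<open>Quotients by covering space actions\<close>

lemma continuous_action_imp_continuous_map:
  assumes "continuous_action G X \<phi>" and g: "g \<in> carrier G"
  shows "continuous_map X X (\<phi> g)"
proof -
  have "continuous_map X (prod_topology (discrete_topology (carrier G)) X) (\<lambda>x. (g, x))"
    using g by (intro continuous_map_pairedI) auto
  from continuous_map_compose[OF this assms(1)[unfolded continuous_action_def]]
  show ?thesis
    by (simp add: o_def)
qed

lemma action_imp_homeomorphic_map:
  fixes G (structure)
  assumes "group_action G (topspace X) \<phi>" and cont: "continuous_action G X \<phi>"
    and g: "g \<in> carrier G"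
  shows "homeomorphic_map X X (\<phi> g)"
proof -
  interpret group_action G "topspace X" \<phi> by fact
  interpret group G
    using group_hom group_hom.axioms(1) by auto
  have "\<phi> (inv g) (\<phi> g x) = x" "\<phi> g (\<phi> (inv g) x) = x" if "x \<in> topspace X" for x
    using orbit_sym_aux[OF g that refl] orbit_sym_aux[OF inv_closed[OF g] that refl] g
    by simp_all
  then have "homeomorphic_maps X X (\<phi> g) (\<phi> (inv g))"
    unfolding homeomorphic_maps_def
    using continuous_action_imp_continuous_map[OF cont] g by blast
  then show ?thesis
    by (rule homeomorphic_maps_imp_map)
qed

text \<open>The criterion for covering space actions.  If \<open>V\<close> is disjoint from its proper translates, then
  all translates are pairwise disjoint and their union is the saturation of \<open>V\<close>, that is, the
  preimage of its image in the quotient; they are the sheets over that image.  The quotient map is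
  open because the saturation of an open set is a union of homeomorphic translates, and it is
  injective on a sheet because two points of one orbit in the same sheet would force two different
  translates of \<open>V\<close> to meet.\<close>

lemma covering_map_orbit:
  fixes G (structure)
  assumes act: "group_action G (topspace X) \<phi>" and cont: "continuous_action G X \<phi>"
    and wandering: "\<And>x. x \<in> topspace X \<Longrightarrow> \<exists>V. openin X V \<and> x \<in> V \<and>
                 (\<forall>g\<in>carrier G. g \<noteq> \<one> \<longrightarrow> disjnt (\<phi> g ` V) V)"
  shows "covering_map X (quotient_topology X (orbit G \<phi>)) (orbit G \<phi>)"
proof -
  interpret group_action G "topspace X" \<phi> by fact
  interpret group G
    using group_hom group_hom.axioms(1) by auto
  let ?p = "orbit G \<phi>" and ?Y = "quotient_topology X (orbit G \<phi>)"
  have homeo: "homeomorphic_map X X (\<phi> g)" if "g \<in> carrier G" for g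
    using action_imp_homeomorphic_map[OF act cont that] .
  have p_act: "?p (\<phi> g x) = ?p x" if "g \<in> carrier G" "x \<in> topspace X" for g x
  proof -
    have "\<exists>k\<in>carrier G. \<phi> h x = \<phi> k (\<phi> g x)" if "h \<in> carrier G" for h
    proof
      show "\<phi> h x = \<phi> (h \<otimes> inv g) (\<phi> g x)"
        using that \<open>g \<in> carrier G\<close> \<open>x \<in> topspace X\<close>
        by (simp add: composition_rule[symmetric] m_assoc)
      show "h \<otimes> inv g \<in> carrier G"
        using that \<open>g \<in> carrier G\<close> by simp
    qed
    moreover have "\<exists>k\<in>carrier G. \<phi> h (\<phi> g x) = \<phi> k x" if "h \<in> carrier G" for h
      using that \<open>g \<in> carrier G\<close> \<open>x \<in> topspace X\<close> by (metis composition_rule m_closed)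
    ultimately show ?thesis
      unfolding orbit_def by blast
  qed
  have p_eqD: "\<exists>g\<in>carrier G. y = \<phi> g x" if "?p x = ?p y" "y \<in> topspace X" for x y
    using orbit_refl[OF that(2)] that(1) by (auto simp: orbit_def)
  have saturation: "{x \<in> topspace X. ?p x \<in> ?p ` W} = (\<Union>g\<in>carrier G. \<phi> g ` W)"
    if "W \<subseteq> topspace X" for W
  proof (intro equalityI subsetI)
    fix x assume "x \<in> {x \<in> topspace X. ?p x \<in> ?p ` W}"
    then obtain w where w: "w \<in> W" "?p w = ?p x" "x \<in> topspace X"
      by (metis (no_types, lifting) imageE mem_Collect_eq)
    then obtain g where "g \<in> carrier G" "x = \<phi> g w"
      using p_eqD[OF w(2,3)] by metis
    with w show "x \<in> (\<Union>g\<in>carrier G. \<phi> g ` W)"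
      by blast
  next
    fix x assume "x \<in> (\<Union>g\<in>carrier G. \<phi> g ` W)"
    then obtain g w where gw: "g \<in> carrier G" "w \<in> W" "x = \<phi> g w"
      by blast
    then have "w \<in> topspace X"
      using that by blast
    with gw have "x \<in> topspace X" "?p x = ?p w"
      using element_image p_act by blast+
    with gw show "x \<in> {x \<in> topspace X. ?p x \<in> ?p ` W}"
      by blast
  qed
  have open_translate: "openin X (\<phi> g ` W)" if "openin X W" "g \<in> carrier G" for g W
    using homeomorphic_map_openness[OF homeo] that openin_subset by blast
  have p_cont: "continuous_map X ?Y ?p"
    by (rule quotient_imp_continuous_map[OF quotient_map_quotient_topology])
  have p_open: "open_map X ?Y ?p"
    unfolding open_map_def
  proof (intro allI impI)
    fix W assume W: "openin X W"
    then have "W \<subseteq> topspace X"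
      by (rule openin_subset)
    with W open_translate show "openin ?Y (?p ` W)"
      by (auto simp: openin_quotient_topology saturation)
  qed
  have even: "\<exists>U. openin ?Y U \<and> ?p x \<in> U \<and>
        (\<exists>\<V>. \<Union>\<V> = {x \<in> topspace X. ?p x \<in> U} \<and>
             (\<forall>V\<in>\<V>. openin X V) \<and> pairwise disjnt \<V> \<and>
             (\<forall>V\<in>\<V>. homeomorphic_map (subtopology X V) (subtopology ?Y U) ?p))"
    if x: "x \<in> topspace X" for x
  proof -
    obtain V where V: "openin X V" "x \<in> V"
      and disj: "\<And>g. g \<in> carrier G \<Longrightarrow> g \<noteq> \<one> \<Longrightarrow> disjnt (\<phi> g ` V) V"
      using wandering[OF x] by blast
    have VX: "V \<subseteq> topspace X"
      using V by (simp add: openin_subset)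
    have act_one: "\<phi> \<one> v = v" if "v \<in> V" for v
      using that VX id_eq_one by (metis restrict_apply' subsetD)
    have same: "g = h" if gh: "g \<in> carrier G" "h \<in> carrier G" and vw: "v \<in> V" "w \<in> V"
      and eq: "\<phi> g v = \<phi> h w" for g h v w
    proof -
      have "\<phi> (inv h \<otimes> g) v = \<phi> (inv h) (\<phi> h w)"
        using gh vw VX eq by (metis composition_rule inv_closed subsetD)
      also have "\<dots> = w"
        using gh vw VX orbit_sym_aux by blast
      finally have "\<phi> (inv h \<otimes> g) v \<in> \<phi> (inv h \<otimes> g) ` V \<inter> V"
        using vw by auto
      with disj[of "inv h \<otimes> g"] have "inv h \<otimes> g = \<one>"
        using gh by (auto simp: disjnt_def)
      then show ?thesis
        using gh by (metis inv_closed inv_equality inv_inv)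
    qed
    have sheet: "homeomorphic_map (subtopology X (\<phi> g ` V)) (subtopology ?Y (?p ` V)) ?p"
      if g: "g \<in> carrier G" for g
    proof (rule bijective_open_imp_homeomorphic_map)
      have sub: "\<phi> g ` V \<subseteq> topspace X"
        using VX g surj_prop by blast
      have im: "?p ` (\<phi> g ` V) = ?p ` V"
        unfolding image_image using VX g by (intro image_cong refl p_act) auto
      have topV: "topspace (subtopology X (\<phi> g ` V)) = \<phi> g ` V"
        using sub by (simp add: Int_absorb1)
      have topU: "topspace (subtopology ?Y (?p ` V)) = ?p ` V"
        using VX by (simp add: Int_absorb1 image_mono)
      show "?p ` topspace (subtopology X (\<phi> g ` V)) = topspace (subtopology ?Y (?p ` V))"
        unfolding topV topU by (rule im)
      have into: "?p \<in> topspace (subtopology X (\<phi> g ` V)) \<rightarrow> ?p ` V"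
        unfolding topV im[symmetric] by blast
      show "continuous_map (subtopology X (\<phi> g ` V)) (subtopology ?Y (?p ` V)) ?p"
        by (intro continuous_map_into_subtopology continuous_map_from_subtopology p_cont into)
      show "open_map (subtopology X (\<phi> g ` V)) (subtopology ?Y (?p ` V)) ?p"
        by (intro open_map_into_subtopology open_map_from_subtopology p_open open_translate V g into)
      show "inj_on ?p (topspace (subtopology X (\<phi> g ` V)))"
        unfolding topV
      proof (rule inj_onI)
        fix a b assume "a \<in> \<phi> g ` V" "b \<in> \<phi> g ` V" "?p a = ?p b"
        then obtain v w where vw: "v \<in> V" "w \<in> V" "a = \<phi> g v" "b = \<phi> g w"
          by blast
        with \<open>?p a = ?p b\<close> have "?p v = ?p w"
          using VX g p_act by (metis subsetD)
        then obtain h where h: "h \<in> carrier G" "w = \<phi> h v"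
          using p_eqD[of v w] vw(2) VX by blast
        \<comment> \<open>\<open>w\<close> lies both in \<open>V\<close> and in its translate by \<open>h\<close>, so \<open>h\<close> is trivial.\<close>
        then have "\<phi> \<one> w = \<phi> h v"
          using vw(2) act_one by simp
        then have "\<one> = h"
          using same[of \<one> h w v] vw(1,2) h(1) by simp
        then have "w = v"
          using h(2) vw(1) act_one by simp
        with vw show "a = b"
          by simp
      qed
    qed
    show ?thesis
    proof (intro exI conjI)
      show "openin ?Y (?p ` V)"
        using p_open V by (auto simp: open_map_def)
      show "?p x \<in> ?p ` V"
        using V by simp
      show "\<Union>((\<lambda>g. \<phi> g ` V) ` carrier G) = {x \<in> topspace X. ?p x \<in> ?p ` V}"
        using saturation[OF VX] by simp
      show "\<forall>W\<in>(\<lambda>g. \<phi> g ` V) ` carrier G. openin X W"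
        using open_translate V by blast
      show "pairwise disjnt ((\<lambda>g. \<phi> g ` V) ` carrier G)"
        unfolding pairwise_def disjnt_iff using same by blast
      show "\<forall>W\<in>(\<lambda>g. \<phi> g ` V) ` carrier G.
              homeomorphic_map (subtopology X W) (subtopology ?Y (?p ` V)) ?p"
        using sheet by blast
    qed
  qed
  show ?thesis
    unfolding covering_map_def using p_cont even by auto
qed

section \<open>A random variable with null fibres\<close>

text \<open>A countable basis of a Polish topology separates points.  The empty set is added to the basis
  before enumerating it because the basis itself may be empty, namely when the space is.\<close>

lemma standard_borel_separating_sequence:
  assumes "standard_borel M"
  obtains U :: "nat \<Rightarrow> 'a set" where "\<And>n. U n \<in> sets M"
    and "\<And>x y. x \<in> space M \<Longrightarrow> y \<in> space M \<Longrightarrow> (\<And>n. x \<in> U n \<longleftrightarrow> y \<in> U n) \<Longrightarrow> x = y"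
proof -
  obtain X where X: "completely_metrizable_space X" "second_countable X" "topspace X = space M"
    and sets: "sets M = sigma_sets (space M) {U. openin X U}"
    using assms by (auto simp: standard_borel_def)
  obtain B where B: "countable B" "\<And>V. V \<in> B \<Longrightarrow> openin X V"
    and basis: "\<And>U x. openin X U \<Longrightarrow> x \<in> U \<Longrightarrow> \<exists>V\<in>B. x \<in> V \<and> V \<subseteq> U"
    using X(2) unfolding second_countable_def by auto
  have "t0_space X"
    using X(1) completely_metrizable_imp_metrizable_space metrizable_imp_t1_space t1_imp_t0_space
    by blast
  define U where "U = from_nat_into (insert {} B)"
  have range: "range U = insert {} B"
    unfolding U_def using B(1) by (intro range_from_nat_into) auto
  show thesis
  proof
    fix n
    have "openin X (U n)"
      using B(2) range by (metis insertE openin_empty rangeI)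
    then show "U n \<in> sets M"
      by (simp add: sets sigma_sets.Basic)
  next
    fix x y assume xy: "x \<in> space M" "y \<in> space M" and eq: "\<And>n. x \<in> U n \<longleftrightarrow> y \<in> U n"
    have B_eq: "x \<in> V \<longleftrightarrow> y \<in> V" if "V \<in> B" for V
      using eq range that by (metis imageE insertCI)
    show "x = y"
    proof (rule ccontr)
      assume "x \<noteq> y"
      then obtain W where "openin X W" "x \<notin> W \<longleftrightarrow> y \<in> W"
        using \<open>t0_space X\<close> xy X(3) unfolding t0_space_def by metis
      then show False
        using basis B_eq by blast
    qed
  qed
qed

text \<open>A set of naturals is encoded by the real number with that set as its ternary digits
  \<open>1\<close>.  In base \<open>3\<close> with digits \<open>0\<close> and \<open>1\<close>, unlike in base \<open>2\<close>, different digit sequences give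
  different numbers: this is a scaled version of the standard parametrisation of the Cantor set.\<close>

definition ternary :: "nat set \<Rightarrow> real" where
  "ternary S = (\<Sum>n. if n \<in> S then (1/3) ^ Suc n else 0)"

lemma sums_ternary_UNIV: "(\<lambda>n. (1/3::real) ^ Suc n) sums (1/2)"
  using sums_mult[OF geometric_sums[of "1/3::real"], of "1/3"] by simp

lemma summable_ternary: "summable (\<lambda>n. if n \<in> S then (1/3::real) ^ Suc n else 0)"
  by (rule summable_comparison_test[OF _ sums_summable[OF sums_ternary_UNIV]]) auto

lemma ternary_bounds: "0 \<le> ternary S" "ternary S \<le> 1"
proof -
  show "0 \<le> ternary S"
    unfolding ternary_def by (rule suminf_nonneg[OF summable_ternary]) auto
  have "ternary S \<le> (\<Sum>n. (1/3::real) ^ Suc n)"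
    unfolding ternary_def
    by (rule suminf_le[OF _ summable_ternary sums_summable[OF sums_ternary_UNIV]]) auto
  also have "\<dots> = 1/2"
    using sums_ternary_UNIV by (rule sums_unique[symmetric])
  finally show "ternary S \<le> 1"
    by simp
qed

text \<open>The digits after position \<open>n\<close> contribute at most half of what the digit at position \<open>n\<close>
  does, so the first digit that differs decides the order.\<close>

lemma ternary_less:
  assumes agree: "\<And>k. k < n \<Longrightarrow> k \<in> S \<longleftrightarrow> k \<in> T" and n: "n \<in> S" "n \<notin> T"
  shows "ternary T < ternary S"
proof -
  let ?F = "\<lambda>S k. if k \<in> S then (1/3::real) ^ Suc k else 0"
  have split: "ternary R = (\<Sum>k. ?F R (k + Suc n)) + ?F R n + (\<Sum>k<n. ?F R k)" for R
    unfolding ternary_def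
    by (subst suminf_split_initial_segment[OF summable_ternary, of _ "Suc n"]) simp
  have tail: "(\<lambda>k. (1/3::real) ^ Suc (k + Suc n)) sums ((1/3) ^ Suc n / 2)"
    using sums_mult[OF sums_ternary_UNIV, of "(1/3) ^ Suc n"]
    by (simp add: power_add mult_ac)
  have "(\<Sum>k. ?F T (k + Suc n)) \<le> (\<Sum>k. (1/3::real) ^ Suc (k + Suc n))"
    by (rule suminf_le[OF _ summable_ignore_initial_segment[OF summable_ternary]
          sums_summable[OF tail]]) auto
  also have "\<dots> = (1/3) ^ Suc n / 2"
    using tail by (rule sums_unique[symmetric])
  finally have "(\<Sum>k. ?F T (k + Suc n)) \<le> (1/3) ^ Suc n / 2" .
  moreover have "0 \<le> (\<Sum>k. ?F S (k + Suc n))"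
    by (rule suminf_nonneg[OF summable_ignore_initial_segment[OF summable_ternary]]) auto
  moreover have "(\<Sum>k<n. ?F T k) = (\<Sum>k<n. ?F S k)"
    using agree by (intro sum.cong) auto
  moreover have "0 < (1/3::real) ^ Suc n"
    by simp
  moreover have "?F S n = (1/3) ^ Suc n" "?F T n = 0"
    using n by auto
  ultimately show ?thesis
    using split[of S] split[of T] by linarith
qed

lemma inj_ternary: "inj ternary"
proof (rule injI, rule ccontr)
  fix S T assume eq: "ternary S = ternary T" and "S \<noteq> T"
  define n where "n = (LEAST n. (n \<in> S) \<noteq> (n \<in> T))"
  have "(n \<in> S) \<noteq> (n \<in> T)"
    unfolding n_def using \<open>S \<noteq> T\<close> by (intro LeastI_ex[of "\<lambda>n. (n \<in> S) \<noteq> (n \<in> T)"]) auto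
  moreover have "(k \<in> S) = (k \<in> T)" if "k < n" for k
    using not_less_Least[of k "\<lambda>n. (n \<in> S) \<noteq> (n \<in> T)"] that unfolding n_def by blast
  ultimately show False
    using ternary_less[of n S T] ternary_less[of n T S] eq by auto
qed

lemma (in prob_space) measure_subsingleton_eq_0:
  assumes "nonatomic M" and A: "A \<in> sets M" and sub: "\<And>x y. x \<in> A \<Longrightarrow> y \<in> A \<Longrightarrow> x = y"
  shows "measure M A = 0"
proof (rule ccontr)
  assume "measure M A \<noteq> 0"
  then have "0 < emeasure M A"
    by (simp add: emeasure_eq_measure less_le measure_nonneg)
  then obtain B where B: "B \<subseteq> A" "0 < emeasure M B" "emeasure M B < emeasure M A"
    using assms(1) A unfolding nonatomic_def by blast
  have "B = {} \<or> B = A"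
    using sub B(1) by blast
  with B show False
    by auto
qed

text \<open>Recording which members of a countable separating family contain a point, and encoding the
  answer as a real number, gives an injective random variable.  Its fibres have at most one point,
  so they are null.\<close>

lemma (in prob_space) ex_null_fibres:
  assumes "standard_borel M" and "nonatomic M"
  obtains \<tau> :: "'a \<Rightarrow> real" where "\<tau> \<in> borel_measurable M"
    and "\<And>t. 0 \<le> \<tau> t" "\<And>t. \<tau> t \<le> 1"
    and "\<And>r. measure M {t \<in> space M. \<tau> t = r} = 0"
proof -
  obtain U :: "nat \<Rightarrow> 'a set" where U: "\<And>n. U n \<in> sets M"
    and sep: "\<And>x y. x \<in> space M \<Longrightarrow> y \<in> space M \<Longrightarrow> (\<And>n. x \<in> U n \<longleftrightarrow> y \<in> U n) \<Longrightarrow> x = y"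
    using standard_borel_separating_sequence[OF assms(1)] by metis
  define \<tau> where "\<tau> t = ternary {n. t \<in> U n}" for t
  have [measurable]: "U n \<in> sets M" for n
    by (rule U)
  have meas [measurable]: "\<tau> \<in> borel_measurable M"
    unfolding \<tau>_def ternary_def mem_Collect_eq by measurable
  have "measure M {t \<in> space M. \<tau> t = r} = 0" for r
  proof (rule measure_subsingleton_eq_0[OF assms(2)])
    show "{t \<in> space M. \<tau> t = r} \<in> sets M"
      by measurable
    fix x y assume "x \<in> {t \<in> space M. \<tau> t = r}" "y \<in> {t \<in> space M. \<tau> t = r}"
    then show "x = y"
      using sep injD[OF inj_ternary, of "{n. x \<in> U n}" "{n. y \<in> U n}"]
      by (auto simp: \<tau>_def set_eq_iff)
  qed
  moreover have "0 \<le> \<tau> t" "\<tau> t \<le> 1" for t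
    by (simp_all add: \<tau>_def ternary_bounds)
  ultimately show thesis
    using meas that by blast
qed

text \<open>A distribution function jumps exactly at the atoms of the distribution.\<close>

lemma (in prob_space) continuous_cdf_of_null_fibres:
  fixes \<tau> :: "'a \<Rightarrow> real"
  assumes [measurable]: "\<tau> \<in> borel_measurable M"
    and null: "\<And>r. measure M {t \<in> space M. \<tau> t = r} = 0"
  shows "isCont (\<lambda>r. measure M {t \<in> space M. \<tau> t \<le> r}) r"
proof -
  interpret D: real_distribution "distr M borel \<tau>"
    by (rule real_distribution_distr) simp
  have "measure (distr M borel \<tau>) {r} = 0"
    using null[of r] by (simp add: measure_distr vimage_def Int_def conj_commute)
  then have "isCont (cdf (distr M borel \<tau>)) r"
    by (simp add: D.isCont_cdf)
  moreover have "cdf (distr M borel \<tau>) = (\<lambda>r. measure M {t \<in> space M. \<tau> t \<le> r})"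
    by (simp add: fun_eq_iff cdf_def measure_distr vimage_def Int_def conj_commute)
  ultimately show ?thesis
    by simp
qed

section \<open>The metric on classes of Borel maps\<close>

locale borel_map_space = prob_space M + group G
  for M :: "'a measure" and G :: "('g, 'm) monoid_scheme" (structure) +
  assumes standard: "standard_borel M"
begin

abbreviation cls :: "('a \<Rightarrow> 'g) \<Rightarrow> ('a \<Rightarrow> 'g) set" where
  "cls f \<equiv> ae_rel M G `` {f}"

lemma borel_maps_pred:
  assumes "f \<in> borel_maps M G"
  shows "Measurable.pred M (\<lambda>t. P (f t))"
  using measurable_compose[OF assms[unfolded borel_maps_def], of P "count_space UNIV"]
  by simp

lemma borel_maps_carrier: "f \<in> borel_maps M G \<Longrightarrow> t \<in> space M \<Longrightarrow> f t \<in> carrier G"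
  unfolding borel_maps_def by (auto dest: measurable_space)

lemma borel_maps_translate:
  assumes "f \<in> borel_maps M G" "g \<in> carrier G"
  shows "(\<lambda>t. g \<otimes> f t) \<in> borel_maps M G"
  using measurable_compose[OF assms(1)[unfolded borel_maps_def], of "(\<otimes>) g" "count_space (carrier G)"]
    assms(2) by (simp add: borel_maps_def)

text \<open>This is where standardness of the space enters for uncountable \<open>G\<close>.  A section \<open>s\<close> of \<open>f\<close>
  embeds the range of \<open>f\<close> into the space, so countably many sets of the form
  \<open>{y. s y \<in> U n}\<close> separate the points of that range.  The section itself has no measurability, but
  none is required of a subset of the discrete group.  Disagreement of \<open>f\<close> and \<open>h\<close> is thereby a
  countable union of conditions on \<open>f\<close> and \<open>h\<close> separately, up to the case that \<open>h\<close> leaves the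
  range of \<open>f\<close>.\<close>

lemma pred_neq:
  assumes f: "f \<in> borel_maps M G" and h: "h \<in> borel_maps M G"
  shows "Measurable.pred M (\<lambda>t. f t \<noteq> h t)"
proof -
  obtain U :: "nat \<Rightarrow> 'a set"
    where sep: "\<And>x y. x \<in> space M \<Longrightarrow> y \<in> space M \<Longrightarrow> (\<And>n. x \<in> U n \<longleftrightarrow> y \<in> U n) \<Longrightarrow> x = y"
    using standard_borel_separating_sequence[OF standard] by metis
  define s where "s = inv_into (space M) f"
  have s: "s y \<in> space M" "f (s y) = y" if "y \<in> f ` space M" for y
    using that by (auto simp: s_def inv_into_into f_inv_into_f)
  have "f t \<noteq> h t \<longleftrightarrow> h t \<notin> f ` space M \<or> (\<exists>n. (s (f t) \<in> U n) \<noteq> (s (h t) \<in> U n))"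
    if "t \<in> space M" for t
    using sep[of "s (f t)" "s (h t)"] s[of "f t"] s[of "h t"] that by (metis imageI)
  moreover have "Measurable.pred M
      (\<lambda>t. h t \<notin> f ` space M \<or> (\<exists>n. (s (f t) \<in> U n) \<noteq> (s (h t) \<in> U n)))"
    using borel_maps_pred[OF f] borel_maps_pred[OF h] by measurable
  ultimately show ?thesis
    by (simp cong: measurable_cong)
qed

lemma sets_neq:
  assumes "f \<in> borel_maps M G" "h \<in> borel_maps M G"
  shows "{t \<in> space M. f t \<noteq> h t} \<in> events"
  using pred_neq[OF assms] by measurable

lemma L_dist_eq_prob:
  assumes f: "f \<in> borel_maps M G" and h: "h \<in> borel_maps M G"
  shows "L_dist M (cls f) (cls h) = prob {t \<in> space M. f t \<noteq> h t}"
proof -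
  have "(\<integral>\<^sup>+t. ennreal (discrete_metric.dd (f t) (h t)) \<partial>M) =
        (\<integral>\<^sup>+t. indicator {t \<in> space M. f t \<noteq> h t} t \<partial>M)"
    by (intro nn_integral_cong) (auto simp: discrete_metric.dd_def indicator_def)
  also have "\<dots> = emeasure M {t \<in> space M. f t \<noteq> h t}"
    using sets_neq[OF f h] by simp
  finally show ?thesis
    by (simp add: L_dist_class[OF f h] measure_def)
qed

lemma L_cases:
  assumes "A \<in> L M G"
  obtains f where "f \<in> borel_maps M G" "A = cls f"
  using assms unfolding L_def by (auto elim: quotientE)

lemma cls_in_L: "f \<in> borel_maps M G \<Longrightarrow> cls f \<in> L M G"
  unfolding L_def by (rule quotientI)

lemma cls_eq:
  assumes "f \<in> borel_maps M G" "h \<in> borel_maps M G" "AE t in M. f t = h t"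
  shows "cls f = cls h"
  using assms by (intro equiv_class_eq[OF equiv_ae_rel]) (simp add: ae_rel_def)

lemma L_dist_eq_0_iff:
  assumes f: "f \<in> borel_maps M G" and h: "h \<in> borel_maps M G"
  shows "L_dist M (cls f) (cls h) = 0 \<longleftrightarrow> cls f = cls h"
proof
  assume "L_dist M (cls f) (cls h) = 0"
  then have "AE t in M. f t = h t"
    using L_dist_eq_prob[OF f h] sets_neq[OF f h]
    by (intro AE_I[of _ _ "{t \<in> space M. f t \<noteq> h t}"]) (auto simp: emeasure_eq_measure)
  then show "cls f = cls h"
    by (rule cls_eq[OF f h])
next
  assume "cls f = cls h"
  then have "L_dist M (cls f) (cls h) = L_dist M (cls h) (cls h)"
    by simp
  also have "\<dots> = 0"
    by (simp add: L_dist_eq_prob[OF h h])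
  finally show "L_dist M (cls f) (cls h) = 0" .
qed

lemma Metric_space_L: "Metric_space (L M G) (L_dist M)"
proof
  fix A B
  show "0 \<le> L_dist M A B"
    by (simp add: L_dist_def)
  show "L_dist M A B = L_dist M B A"
    unfolding L_dist_def by (simp add: discrete_metric.dd_def eq_commute)
next
  fix A B assume "A \<in> L M G" "B \<in> L M G"
  then show "L_dist M A B = 0 \<longleftrightarrow> A = B"
    by (metis L_cases L_dist_eq_0_iff)
next
  fix A B C assume "A \<in> L M G" "B \<in> L M G" "C \<in> L M G"
  then obtain f g h where f: "f \<in> borel_maps M G" "A = cls f"
    and g: "g \<in> borel_maps M G" "B = cls g" and h: "h \<in> borel_maps M G" "C = cls h"
    by (metis L_cases)
  have "prob {t \<in> space M. f t \<noteq> h t}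
      \<le> prob ({t \<in> space M. f t \<noteq> g t} \<union> {t \<in> space M. g t \<noteq> h t})"
    using f g h by (intro finite_measure_mono sets.Un sets_neq) auto
  also have "\<dots> \<le> prob {t \<in> space M. f t \<noteq> g t} + prob {t \<in> space M. g t \<noteq> h t}"
    using f g h by (intro measure_Un_le sets_neq)
  finally show "L_dist M A C \<le> L_dist M A B + L_dist M B C"
    using f g h by (simp add: L_dist_eq_prob)
qed

sublocale L: Metric_space "L M G" "L_dist M"
  by (rule Metric_space_L)

lemma topspace_L_top: "topspace (L_top M G) = L M G"
  by (simp add: L_top_def)

section \<open>Contractibility\<close>

text \<open>The homotopy \<open>H\<close> sends a class \<open>A\<close> at time \<open>r\<close> to the class of the map that is \<open>\<one>\<close> where
  \<open>\<tau> \<le> r\<close> and agrees with a representative of \<open>A\<close> elsewhere.  At time \<open>0\<close> only the null set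
  \<open>\<tau> = 0\<close> is overwritten, at time \<open>1\<close> everything is.\<close>

lemma contractible_space_L:
  assumes "nonatomic M"
  shows "contractible_space (L_top M G)"
proof -
  obtain \<tau> :: "'a \<Rightarrow> real" where [measurable]: "\<tau> \<in> borel_measurable M"
    and \<tau>: "\<And>t. 0 \<le> \<tau> t" "\<And>t. \<tau> t \<le> 1"
    and null: "\<And>r. prob {t \<in> space M. \<tau> t = r} = 0"
    using ex_null_fibres[OF standard assms] by metis
  define F where "F r = prob {t \<in> space M. \<tau> t \<le> r}" for r
  have F_cont: "isCont F r" for r
    unfolding F_def by (rule continuous_cdf_of_null_fibres) (auto simp: null)
  have slab: "prob {t \<in> space M. (\<tau> t \<le> r) \<noteq> (\<tau> t \<le> s)} \<le> \<bar>F s - F r\<bar>" for r s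
  proof (induction r s rule: linorder_wlog)
    case (le r s)
    have "{t \<in> space M. (\<tau> t \<le> r) \<noteq> (\<tau> t \<le> s)} = {t \<in> space M. \<tau> t \<le> s} - {t \<in> space M. \<tau> t \<le> r}"
      using le by auto
    also have "prob \<dots> = F s - F r"
      unfolding F_def using le by (intro finite_measure_Diff) auto
    finally show ?case
      by simp
  next
    case (sym r s)
    then show ?case
      by (simp add: eq_commute abs_minus_commute)
  qed
  define rep where "rep A = (SOME f. f \<in> borel_maps M G \<and> A = cls f)" for A
  have rep: "rep A \<in> borel_maps M G" "cls (rep A) = A" if "A \<in> L M G" for A
    using someI_ex[of "\<lambda>f. f \<in> borel_maps M G \<and> A = cls f"] L_cases[OF that]
    unfolding rep_def by blast+
  \<comment> \<open>Working with one chosen representative per class makes \<open>H\<close> well defined by construction.\<close>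
  define cut where "cut r f t = (if \<tau> t \<le> r then \<one> else f t)" for r f t
  have cut: "cut r f \<in> borel_maps M G" if "f \<in> borel_maps M G" for r f
    using that unfolding borel_maps_def cut_def by measurable
  define H where "H = (\<lambda>(r, A). cls (cut r (rep A)))"
  have H_in: "H (r, A) \<in> L M G" if "A \<in> L M G" for r A
    unfolding H_def using that by (simp add: cls_in_L cut rep)
  \<comment> \<open>Joint continuity in time and space at once: the cut maps can disagree only between the two
    levels or where the representatives disagree.\<close>
  have H_dist: "L_dist M (H (r, A)) (H (s, B)) \<le> \<bar>F s - F r\<bar> + L_dist M A B"
    if A: "A \<in> L M G" and B: "B \<in> L M G" for r s A B
  proof -
    have "L_dist M (H (r, A)) (H (s, B)) = prob {t \<in> space M. cut r (rep A) t \<noteq> cut s (rep B) t}"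
      unfolding H_def using A B by (simp add: L_dist_eq_prob cut rep)
    also have "\<dots> \<le> prob ({t \<in> space M. (\<tau> t \<le> r) \<noteq> (\<tau> t \<le> s)} \<union> {t \<in> space M. rep A t \<noteq> rep B t})"
      using sets_neq[OF rep(1)[OF A] rep(1)[OF B]]
      by (intro finite_measure_mono) (auto simp: cut_def)
    also have "\<dots> \<le> prob {t \<in> space M. (\<tau> t \<le> r) \<noteq> (\<tau> t \<le> s)} + prob {t \<in> space M. rep A t \<noteq> rep B t}"
      using sets_neq[OF rep(1)[OF A] rep(1)[OF B]]
      by (intro measure_Un_le) auto
    also have "prob {t \<in> space M. rep A t \<noteq> rep B t} = L_dist M A B"
      using L_dist_eq_prob[of "rep A" "rep B"] A B by (simp add: rep)
    finally show ?thesis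
      using slab[of r s] by linarith
  qed
  let ?I = "top_of_set {0..1::real}"
  have "continuous_map (prod_topology ?I (L_top M G)) (L_top M G) H"
    unfolding L_top_def L.continuous_map_to_metric
  proof (intro ballI allI impI)
    fix z and \<epsilon> :: real
    assume "z \<in> topspace (prod_topology ?I L.mtopology)" and "\<epsilon> > 0"
    then obtain r A where z: "z = (r, A)" "r \<in> {0..1}" "A \<in> L M G"
      by auto
    obtain \<delta> where "\<delta> > 0" and \<delta>: "\<And>s. dist s r < \<delta> \<Longrightarrow> \<bar>F s - F r\<bar> < \<epsilon> / 2"
      using F_cont[of r] \<open>\<epsilon> > 0\<close> unfolding continuous_at_eps_delta dist_real_def
      by (metis half_gt_zero)
    let ?U = "({0..1} \<inter> ball r \<delta>) \<times> L.mball A (\<epsilon> / 2)"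
    have "openin (prod_topology ?I L.mtopology) ?U"
      by (simp add: openin_prod_Times_iff openin_open_Int)
    moreover have "z \<in> ?U"
      using z \<open>\<delta> > 0\<close> \<open>\<epsilon> > 0\<close> by simp
    moreover have "H y \<in> L.mball (H z) \<epsilon>" if y: "y \<in> ?U" for y
    proof -
      obtain s B where sB: "y = (s, B)" "dist s r < \<delta>" "B \<in> L M G" "L_dist M A B < \<epsilon> / 2"
        using y by (auto simp: dist_commute)
      with H_dist[OF z(3) sB(3), of r s] \<delta>[of s] show ?thesis
        by (simp add: z H_in)
    qed
    ultimately show "\<exists>U. openin (prod_topology ?I L.mtopology) U \<and> z \<in> U \<and>
                         (\<forall>y\<in>U. H y \<in> L.mball (H z) \<epsilon>)"
      by blast
  qed
  moreover have "H (0, A) = A" if A: "A \<in> L M G" for A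
  proof -
    have "AE t in M. cut 0 (rep A) t = rep A t"
    proof (rule AE_I)
      show "{t \<in> space M. cut 0 (rep A) t \<noteq> rep A t} \<subseteq> {t \<in> space M. \<tau> t = 0}"
        using \<tau>(1) by (auto simp: cut_def intro: antisym)
      show "emeasure M {t \<in> space M. \<tau> t = 0} = 0"
        using null[of 0] by (simp add: emeasure_eq_measure)
      show "{t \<in> space M. \<tau> t = 0} \<in> events"
        by measurable
    qed
    then have "cls (cut 0 (rep A)) = cls (rep A)"
      using A by (intro cls_eq cut rep)
    then show ?thesis
      by (simp add: H_def rep A)
  qed
  moreover have "H (1, A) = cls (\<lambda>t. \<one>)" for A
  proof -
    have "cut 1 (rep A) = (\<lambda>t. \<one>)"
      using \<tau>(2) by (simp add: cut_def fun_eq_iff)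
    then show ?thesis
      by (simp add: H_def)
  qed
  ultimately have "homotopic_with (\<lambda>x. True) (L_top M G) (L_top M G) id (\<lambda>x. cls (\<lambda>t. \<one>))"
    by (subst homotopic_with) (auto simp: topspace_L_top intro!: exI[of _ H])
  then show ?thesis
    unfolding contractible_space_def by blast
qed

section \<open>The action by left translations\<close>

lemma L_act_cls:
  "g \<in> carrier G \<Longrightarrow> f \<in> borel_maps M G \<Longrightarrow> L_act M G g (cls f) = cls (\<lambda>t. g \<otimes> f t)"
  using L_act_class[OF is_group] .

lemma L_act_closed: "g \<in> carrier G \<Longrightarrow> A \<in> L M G \<Longrightarrow> L_act M G g A \<in> L M G"
  by (metis L_act_cls L_cases borel_maps_translate cls_in_L)

lemma L_act_mult:
  assumes g: "g \<in> carrier G" and h: "h \<in> carrier G" and "A \<in> L M G"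
  shows "L_act M G (g \<otimes> h) A = L_act M G g (L_act M G h A)"
proof -
  obtain f where f: "f \<in> borel_maps M G" "A = cls f"
    using L_cases[OF assms(3)] .
  have assoc: "AE t in M. g \<otimes> h \<otimes> f t = g \<otimes> (h \<otimes> f t)"
    using borel_maps_carrier[OF f(1)] g h by (intro AE_I2) (simp add: m_assoc)
  have "cls (\<lambda>t. g \<otimes> h \<otimes> f t) = cls (\<lambda>t. g \<otimes> (h \<otimes> f t))"
    using f(1) g h by (intro cls_eq[OF _ _ assoc] borel_maps_translate m_closed)
  then show ?thesis
    unfolding f(2) using f(1) g h by (simp add: L_act_cls borel_maps_translate)
qed

lemma L_act_one:
  assumes "A \<in> L M G"
  shows "L_act M G \<one> A = A"
proof -
  obtain f where f: "f \<in> borel_maps M G" "A = cls f"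
    using L_cases[OF assms] .
  have one: "AE t in M. \<one> \<otimes> f t = f t"
    using borel_maps_carrier[OF f(1)] by (intro AE_I2) simp
  have "cls (\<lambda>t. \<one> \<otimes> f t) = cls f"
    using f(1) by (intro cls_eq[OF _ _ one] borel_maps_translate one_closed)
  then show ?thesis
    unfolding f(2) using f(1) by (simp add: L_act_cls)
qed

lemma group_action_L: "group_action G (L M G) (L_act M G)"
proof -
  have bij: "L_act M G g \<in> Bij (L M G)" if g: "g \<in> carrier G" for g
  proof -
    have "bij_betw (L_act M G g) (L M G) (L M G)"
    proof (rule bij_betw_byWitness[where f' = "L_act M G (inv g)"])
      show "\<forall>A\<in>L M G. L_act M G (inv g) (L_act M G g A) = A"
        using g by (metis L_act_mult L_act_one inv_closed l_inv)
      show "\<forall>A\<in>L M G. L_act M G g (L_act M G (inv g) A) = A"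
        using g by (metis L_act_mult L_act_one inv_closed r_inv)
    qed (use g L_act_closed in auto)
    moreover have "L_act M G g \<in> extensional (L M G)"
      by (simp add: L_act_def)
    ultimately show ?thesis
      by (simp add: Bij_def)
  qed
  have "L_act M G (g \<otimes> h) = compose (L M G) (L_act M G g) (L_act M G h)"
    if g: "g \<in> carrier G" and h: "h \<in> carrier G" for g h
  proof
    fix A
    show "L_act M G (g \<otimes> h) A = compose (L M G) (L_act M G g) (L_act M G h) A"
    proof (cases "A \<in> L M G")
      case True
      then show ?thesis
        using g h by (simp add: L_act_mult compose_eq)
    next
      case False
      then show ?thesis
        by (simp add: L_act_def compose_def)
    qed
  qed
  with bij have "L_act M G \<in> hom G (BijGroup (L M G))"
    by (auto simp: hom_def BijGroup_def)
  then show ?thesis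
    by (simp add: group_action_def group_hom_def group_hom_axioms_def is_group group_BijGroup)
qed

lemma L_dist_act:
  assumes g: "g \<in> carrier G" and "A \<in> L M G" "B \<in> L M G"
  shows "L_dist M (L_act M G g A) (L_act M G g B) = L_dist M A B"
proof -
  obtain f h where f: "f \<in> borel_maps M G" "A = cls f" and h: "h \<in> borel_maps M G" "B = cls h"
    using assms(2,3) by (metis L_cases)
  have "{t \<in> space M. g \<otimes> f t \<noteq> g \<otimes> h t} = {t \<in> space M. f t \<noteq> h t}"
    using borel_maps_carrier f h g by auto
  then show ?thesis
    using f h g by (simp add: L_act_cls L_dist_eq_prob borel_maps_translate)
qed

text \<open>Translation by \<open>g \<noteq> \<one>\<close> has no fixed point in \<open>G\<close>, so it changes a map at every point.\<close>

lemma L_dist_act_self: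
  assumes g: "g \<in> carrier G" "g \<noteq> \<one>" and "A \<in> L M G"
  shows "L_dist M A (L_act M G g A) = 1"
proof -
  obtain f where f: "f \<in> borel_maps M G" "A = cls f"
    using L_cases[OF assms(3)] .
  have "{t \<in> space M. f t \<noteq> g \<otimes> f t} = space M"
    using borel_maps_carrier f g by (auto dest: sym)
  then show ?thesis
    using f g by (simp add: L_act_cls L_dist_eq_prob borel_maps_translate prob_space)
qed

lemma free_action_L: "free_action G (L M G) (L_act M G)"
  unfolding free_action_def
proof (intro conjI ballI impI)
  fix g A assume "g \<in> carrier G" "A \<in> L M G" "L_act M G g A = A"
  then show "g = \<one>"
    using L_dist_act_self[of g A] by (cases "g = \<one>") auto
qed (rule group_action_L)

lemma continuous_action_L: "continuous_action G (L_top M G) (L_act M G)"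
  unfolding continuous_action_def L_top_def L.continuous_map_to_metric
proof (intro ballI allI impI)
  let ?T = "prod_topology (discrete_topology (carrier G)) L.mtopology"
  fix z and \<epsilon> :: real
  assume "z \<in> topspace ?T" and "\<epsilon> > 0"
  then obtain g A where z: "z = (g, A)" "g \<in> carrier G" "A \<in> L M G"
    by auto
  have "openin ?T ({g} \<times> L.mball A \<epsilon>)"
    using z by (simp add: openin_prod_Times_iff)
  moreover have "z \<in> {g} \<times> L.mball A \<epsilon>"
    using z \<open>\<epsilon> > 0\<close> by simp
  moreover have "\<forall>y\<in>{g} \<times> L.mball A \<epsilon>.
      (case y of (g, x) \<Rightarrow> L_act M G g x) \<in> L.mball (case z of (g, x) \<Rightarrow> L_act M G g x) \<epsilon>"
    using z by (auto simp: L_act_closed L_dist_act)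
  ultimately show "\<exists>U. openin ?T U \<and> z \<in> U \<and>
      (\<forall>y\<in>U. (case y of (g, x) \<Rightarrow> L_act M G g x)
               \<in> L.mball (case z of (g, x) \<Rightarrow> L_act M G g x) \<epsilon>)"
    by blast
qed

text \<open>Balls of radius \<open>1/2\<close> are disjoint from their proper translates: two points of such a ball are at
  distance less than \<open>1\<close>, while a point and its proper translates are at distance \<open>1\<close>.\<close>

lemma covering_map_L:
  "covering_map (L_top M G) (quotient_topology (L_top M G) (orbit G (L_act M G)))
     (orbit G (L_act M G))"
proof (rule covering_map_orbit)
  show "group_action G (topspace (L_top M G)) (L_act M G)"
    by (simp add: topspace_L_top group_action_L)
  show "continuous_action G (L_top M G) (L_act M G)"
    by (rule continuous_action_L)
  fix A assume "A \<in> topspace (L_top M G)"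
  then have A: "A \<in> L M G"
    by (simp add: topspace_L_top)
  have "disjnt (L_act M G g ` L.mball A (1/2)) (L.mball A (1/2))"
    if g: "g \<in> carrier G" "g \<noteq> \<one>" for g
  proof -
    have False if "B \<in> L.mball A (1/2)" "L_act M G g B \<in> L.mball A (1/2)" for B
    proof -
      have "L_dist M B (L_act M G g B) \<le> L_dist M A B + L_dist M A (L_act M G g B)"
        using that L.triangle[of B A "L_act M G g B"] L.commute[of A B] by simp
      also have "\<dots> < 1"
        using that by simp
      finally show False
        using L_dist_act_self[OF g] that by simp
    qed
    then show ?thesis
      unfolding disjnt_iff by blast
  qed
  moreover have "openin (L_top M G) (L.mball A (1/2))"
    by (simp add: L_top_def)
  moreover have "A \<in> L.mball A (1/2)"
    using A by simp
  ultimately show "\<exists>V. openin (L_top M G) V \<and> A \<in> V \<and>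
      (\<forall>g\<in>carrier G. g \<noteq> \<one> \<longrightarrow> disjnt (L_act M G g ` V) V)"
    by blast
qed

end

theorem proposition3p1:
  fixes M :: "'a measure" and G :: "('g, 'm) monoid_scheme"
  assumes "standard_borel M" and "uncountable (space M)"
    and "prob_space M" and "nonatomic M"
    and "group G"
  shows "contractible_space (L_top M G) \<and>
         free_action G (L M G) (L_act M G) \<and>
         continuous_action G (L_top M G) (L_act M G) \<and>
         covering_map (L_top M G)
           (quotient_topology (L_top M G) (orbit G (L_act M G)))
           (orbit G (L_act M G))"
proof -
  interpret borel_map_space M G
    using assms by (simp add: borel_map_space_def borel_map_space_axioms_def)
  show ?thesis
    by (intro conjI contractible_space_L[OF assms(4)] free_action_L continuous_action_L
        covering_map_L)
qed

end
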